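(* Let $a>0$ and $b>1$, let $R(x)=1+\frac{a}{x}$ and $S(x)=\frac{x}{b}$, let $\Lambda$ be the semigroup generated by $R$ and $S$, and let $\bar\Lambda$ be its closure under pointwise convergence on $(0,\infty)$. Then $$\bar\Lambda\cap\mathcal{F}^+=\bigcup_{k\in\mathbb{Z}}U_k,$$ where for $k\in\mathbb{Z}$, $$U_k=\{f\in\mathcal{F}^+:\ \det(f)\le \min(b^k,\ b^{-k}\sigma(f))\}.$$
   Context: $\mathcal{F}$ denotes the set of real linear fractional transformations $f(x)=\frac{\alpha x+\beta}{\gamma x+\delta}$ with $\alpha,\beta,\gamma,\delta\ge0$ and $\alpha\delta-\beta\gamma\ne0$, regarded as maps $(0,\infty)\to(0,\infty)$. For such $f$ with $\delta\neq0$, set $\det(f)=\frac{\alpha\delta-\beta\gamma}{\delta^2}$ and $\sigma(f)=\frac{\alpha^2}{\delta^2}$ (these do not depend on the choice of representing coefficients). $\mathcal{F}^+=\{f\in\mathcal{F}: \delta\neq 0,\ \det(f)\ge 0\}$. $\Lambda$ consists of all finite compositions of $R$ and $S$ (including the identity). $\bar\Lambda$ denotes the set of all functions $h:(0,\infty)\to[0,\infty)$ that are pointwise limits on $(0,\infty)$ of sequences of elements of $\Lambda$. *)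

theory Defs
  imports Complex_Main "HOL-Library.FuncSet"
begin

text \<open>Functions on the open half-line are represented as HOL functions that are extensional
  on \<open>{0<..}\<close> (with value \<open>undefined\<close> elsewhere), so that HOL equality of
  two such functions is equality on the open half-line.\<close>

definition lft :: "real \<Rightarrow> real \<Rightarrow> real \<Rightarrow> real \<Rightarrow> (real \<Rightarrow> real)" where
  "lft \<alpha> \<beta> \<gamma> \<delta> = (\<lambda>x\<in>{0<..}. (\<alpha> * x + \<beta>) / (\<gamma> * x + \<delta>))"

definition lft_rep :: "(real \<Rightarrow> real) \<Rightarrow> real \<Rightarrow> real \<Rightarrow> real \<Rightarrow> real \<Rightarrow> bool" where
  "lft_rep f \<alpha> \<beta> \<gamma> \<delta> \<longleftrightarrow>
     0 \<le> \<alpha> \<and> 0 \<le> \<beta> \<and> 0 \<le> \<gamma> \<and> 0 \<le> \<delta> \<and> \<alpha> * \<delta> - \<beta> * \<gamma> \<noteq> 0 \<and> f = lft \<alpha> \<beta> \<gamma> \<delta>"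

definition LFT :: "(real \<Rightarrow> real) set" where
  "LFT = {f. \<exists>\<alpha> \<beta> \<gamma> \<delta>. lft_rep f \<alpha> \<beta> \<gamma> \<delta>}"

text \<open>The definite descriptions below are meaningful for \<open>f\<close> with a representation such that
  \<open>\<delta> \<noteq> 0\<close>; independence of the representation is shown in \<open>lft_det_eq\<close> and
  \<open>lft_sigma_eq\<close>.\<close>

definition lft_det :: "(real \<Rightarrow> real) \<Rightarrow> real" where
  "lft_det f = (THE d. \<exists>\<alpha> \<beta> \<gamma> \<delta>. lft_rep f \<alpha> \<beta> \<gamma> \<delta> \<and> \<delta> \<noteq> 0 \<and> d = (\<alpha> * \<delta> - \<beta> * \<gamma>) / \<delta>\<^sup>2)"

definition lft_sigma :: "(real \<Rightarrow> real) \<Rightarrow> real" where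
  "lft_sigma f = (THE s. \<exists>\<alpha> \<beta> \<gamma> \<delta>. lft_rep f \<alpha> \<beta> \<gamma> \<delta> \<and> \<delta> \<noteq> 0 \<and> s = \<alpha>\<^sup>2 / \<delta>\<^sup>2)"

definition LFT_plus :: "(real \<Rightarrow> real) set" where
  "LFT_plus = {f \<in> LFT. (\<exists>\<alpha> \<beta> \<gamma> \<delta>. lft_rep f \<alpha> \<beta> \<gamma> \<delta> \<and> \<delta> \<noteq> 0) \<and> lft_det f \<ge> 0}"

definition R_map :: "real \<Rightarrow> (real \<Rightarrow> real)" where
  "R_map a = (\<lambda>x\<in>{0<..}. 1 + a / x)"

definition S_map :: "real \<Rightarrow> (real \<Rightarrow> real)" where
  "S_map b = (\<lambda>x\<in>{0<..}. x / b)"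

inductive_set Lambda :: "real \<Rightarrow> real \<Rightarrow> (real \<Rightarrow> real) set" for a b :: real where
  Lambda_id: "(\<lambda>x\<in>{0<..}. x) \<in> Lambda a b"
| Lambda_R: "f \<in> Lambda a b \<Longrightarrow> compose {0<..} (R_map a) f \<in> Lambda a b"
| Lambda_S: "f \<in> Lambda a b \<Longrightarrow> compose {0<..} (S_map b) f \<in> Lambda a b"

definition Lambda_bar :: "real \<Rightarrow> real \<Rightarrow> (real \<Rightarrow> real) set" where
  "Lambda_bar a b = {h \<in> {0<..} \<rightarrow>\<^sub>E {0..}.
     \<exists>g :: nat \<Rightarrow> real \<Rightarrow> real. (\<forall>n. g n \<in> Lambda a b) \<and> (\<forall>x>0. (\<lambda>n. g n x) \<longlonglongrightarrow> h x)}"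

definition U_set :: "real \<Rightarrow> int \<Rightarrow> (real \<Rightarrow> real) set" where
  "U_set b k = {f \<in> LFT_plus. lft_det f \<le> min (b powi k) (b powi (- k) * lft_sigma f)}"

lemma lft_rep_cross:
  assumes f: "lft_rep f \<alpha> \<beta> \<gamma> \<delta>" and g: "lft_rep f \<alpha>' \<beta>' \<gamma>' \<delta>'" and x: "x > 0"
  shows "(\<alpha> * x + \<beta>) * (\<gamma>' * x + \<delta>') = (\<alpha>' * x + \<beta>') * (\<gamma> * x + \<delta>)"
proof -
  have pos: "c * x + d > 0" if "c \<ge> 0" "d \<ge> 0" "p * d - q * c \<noteq> 0" for p q c d :: real
  proof (cases "c = 0")
    case True
    then show ?thesis using that by (cases "d = 0") auto
  next
    case False
    then show ?thesis using that x by (simp add: add_pos_nonneg)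
  qed
  have "\<gamma> * x + \<delta> > 0" "\<gamma>' * x + \<delta>' > 0"
    using pos[of \<gamma> \<delta> \<alpha> \<beta>] pos[of \<gamma>' \<delta>' \<alpha>' \<beta>'] f g by (auto simp: lft_rep_def)
  moreover have "lft \<alpha> \<beta> \<gamma> \<delta> x = lft \<alpha>' \<beta>' \<gamma>' \<delta>' x"
    using f g by (simp add: lft_rep_def)
  ultimately show ?thesis
    using x by (simp add: lft_def frac_eq_eq)
qed

lemma lft_rep_unique:
  assumes f: "lft_rep f \<alpha> \<beta> \<gamma> \<delta>" "\<delta> \<noteq> 0" and g: "lft_rep f \<alpha>' \<beta>' \<gamma>' \<delta>'" "\<delta>' \<noteq> 0"
  shows "\<alpha> / \<delta> = \<alpha>' / \<delta>'" "\<beta> / \<delta> = \<beta>' / \<delta>'" "\<gamma> / \<delta> = \<gamma>' / \<delta>'"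
proof -
  define A B C where "A = \<alpha> * \<gamma>' - \<alpha>' * \<gamma>" and "B = \<alpha> * \<delta>' + \<beta> * \<gamma>' - \<alpha>' * \<delta> - \<beta>' * \<gamma>"
    and "C = \<beta> * \<delta>' - \<beta>' * \<delta>"
  have quad: "A * x\<^sup>2 + B * x + C = 0" if "x > 0" for x
    using lft_rep_cross[OF f(1) g(1) that]
    by (simp add: A_def B_def C_def power2_eq_square algebra_simps)
  have "A = 0 \<and> B = 0 \<and> C = 0"
    using quad[of 1] quad[of 2] quad[of 3] by simp
  then have A: "\<alpha> * \<gamma>' = \<alpha>' * \<gamma>" and B: "\<alpha> * \<delta>' + \<beta> * \<gamma>' = \<alpha>' * \<delta> + \<beta>' * \<gamma>"
    and C: "\<beta> * \<delta>' = \<beta>' * \<delta>"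
    by (auto simp: A_def B_def C_def)
  have D: "\<alpha> * \<delta> - \<beta> * \<gamma> \<noteq> 0" using f by (simp add: lft_rep_def)
  define p r where "p = \<alpha> * \<delta>' - \<alpha>' * \<delta>" and "r = \<gamma> * \<delta>' - \<gamma>' * \<delta>"
  have 1: "\<delta> * p = \<beta> * r"
    using B C unfolding p_def r_def by algebra
  have 2: "\<gamma> * p = \<alpha> * r"
    using A unfolding p_def r_def by algebra
  have "(\<alpha> * \<delta> - \<beta> * \<gamma>) * p = 0" "(\<alpha> * \<delta> - \<beta> * \<gamma>) * r = 0"
    using 1 2 by algebra+
  then have "p = 0" "r = 0" using D by auto
  then show "\<alpha> / \<delta> = \<alpha>' / \<delta>'" "\<beta> / \<delta> = \<beta>' / \<delta>'" "\<gamma> / \<delta> = \<gamma>' / \<delta>'"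
    using f(2) g(2) C by (auto simp: p_def r_def frac_eq_eq)
qed

lemma lft_det_eq:
  assumes "lft_rep f \<alpha> \<beta> \<gamma> \<delta>" "\<delta> \<noteq> 0"
  shows "lft_det f = (\<alpha> * \<delta> - \<beta> * \<gamma>) / \<delta>\<^sup>2"
  unfolding lft_det_def
proof (rule the_equality)
  show "\<exists>\<alpha>' \<beta>' \<gamma>' \<delta>'. lft_rep f \<alpha>' \<beta>' \<gamma>' \<delta>' \<and> \<delta>' \<noteq> 0 \<and>
      (\<alpha> * \<delta> - \<beta> * \<gamma>) / \<delta>\<^sup>2 = (\<alpha>' * \<delta>' - \<beta>' * \<gamma>') / \<delta>'\<^sup>2"
    using assms by blast
next
  fix d
  assume "\<exists>\<alpha> \<beta> \<gamma> \<delta>. lft_rep f \<alpha> \<beta> \<gamma> \<delta> \<and> \<delta> \<noteq> 0 \<and> d = (\<alpha> * \<delta> - \<beta> * \<gamma>) / \<delta>\<^sup>2"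
  then obtain \<alpha>' \<beta>' \<gamma>' \<delta>' where r: "lft_rep f \<alpha>' \<beta>' \<gamma>' \<delta>'" "\<delta>' \<noteq> 0"
    and d: "d = (\<alpha>' * \<delta>' - \<beta>' * \<gamma>') / \<delta>'\<^sup>2"
    by blast
  have n: "(p * s - q * t) / s\<^sup>2 = p / s - (q / s) * (t / s)" if "s \<noteq> 0" for p q s t :: real
    using that by (simp add: field_simps power2_eq_square)
  show "d = (\<alpha> * \<delta> - \<beta> * \<gamma>) / \<delta>\<^sup>2"
    unfolding d n[OF r(2)] n[OF assms(2)] using lft_rep_unique[OF assms r] by simp
qed

lemma lft_sigma_eq:
  assumes "lft_rep f \<alpha> \<beta> \<gamma> \<delta>" "\<delta> \<noteq> 0"
  shows "lft_sigma f = \<alpha>\<^sup>2 / \<delta>\<^sup>2"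
  unfolding lft_sigma_def
proof (rule the_equality)
  show "\<exists>\<alpha>' \<beta>' \<gamma>' \<delta>'. lft_rep f \<alpha>' \<beta>' \<gamma>' \<delta>' \<and> \<delta>' \<noteq> 0 \<and> \<alpha>\<^sup>2 / \<delta>\<^sup>2 = \<alpha>'\<^sup>2 / \<delta>'\<^sup>2"
    using assms by blast
next
  fix s
  assume "\<exists>\<alpha> \<beta> \<gamma> \<delta>. lft_rep f \<alpha> \<beta> \<gamma> \<delta> \<and> \<delta> \<noteq> 0 \<and> s = \<alpha>\<^sup>2 / \<delta>\<^sup>2"
  then show "s = \<alpha>\<^sup>2 / \<delta>\<^sup>2"
    using lft_rep_unique(1)[OF assms] by (metis power_divide)
qed

end

theory Submission
  imports Defs "HOL-Analysis.Elementary_Metric_Spaces"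
begin

text \<open>A composition with positive determinant carries an integer \<open>k\<close> such that its coefficients,
  with \<open>D = \<alpha> * \<delta> - \<beta> * \<gamma>\<close>, satisfy \<open>D \<le> b powi k * \<delta>\<^sup>2\<close> and \<open>b powi k * D \<le> \<alpha>\<^sup>2\<close>; a twisted
  version of this condition handles compositions of negative determinant. Pointwise convergence to
  a function in \<open>LFT_plus\<close> forces convergence of the coefficients normalised by \<open>\<delta> = 1\<close>, and the
  condition survives the limit because the powers of \<open>b\<close> are discrete.

  Conversely, \<open>S ^ m R S ^ m\<close> converges to the inversion \<open>J x = a / x\<close>. Then \<open>J S J\<close> is
  multiplication by \<open>b\<close> and \<open>R J\<close> is the translation by \<open>1\<close>, so that conjugation by powers of \<open>S\<close>
  and density yield all translations by nonnegative numbers, and conjugation by \<open>J\<close> all lower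
  unipotent maps. Every nonnegative matrix of determinant \<open>1\<close> with diagonal entries at least \<open>1\<close>
  is a product of upper and lower unipotent ones, and the members of \<open>U_k\<close> are such matrices
  composed with multiplication by \<open>b powi k\<close>.\<close>

section \<open>Coefficients\<close>

text \<open>A zero row would make the determinant vanish, so numerator and denominator each have a
  positive coefficient.\<close>

lemma lft_rep_pos:
  assumes "lft_rep f p q r s" "x > 0"
  shows "p * x + q > 0" "r * x + s > 0"
proof -
  have "p > 0 \<or> q > 0" "r > 0 \<or> s > 0" and nn: "p \<ge> 0" "q \<ge> 0" "r \<ge> 0" "s \<ge> 0"
    using assms(1) by (auto simp: lft_rep_def less_le)
  then show "p * x + q > 0" "r * x + s > 0"
    using assms(2) by (auto intro: add_pos_nonneg add_nonneg_pos)
qed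

lemma lft_rep_apply:
  "lft_rep f p q r s \<Longrightarrow> x > 0 \<Longrightarrow> f x = (p * x + q) / (r * x + s)"
  by (simp add: lft_rep_def lft_def)

lemma lft_rep_compose:
  assumes f: "lft_rep f p q r s" and g: "lft_rep g p' q' r' s'"
  shows "lft_rep (compose {0<..} f g)
    (p * p' + q * r') (p * q' + q * s') (r * p' + s * r') (r * q' + s * s')"
proof -
  have "(p * p' + q * r') * (r * q' + s * s') - (p * q' + q * s') * (r * p' + s * r')
    = (p * s - q * r) * (p' * s' - q' * r')"
    by (simp add: algebra_simps)
  then have det: "(p * p' + q * r') * (r * q' + s * s') - (p * q' + q * s') * (r * p' + s * r') \<noteq> 0"
    using f g by (simp add: lft_rep_def)
  have "compose {0<..} f g
    = lft (p * p' + q * r') (p * q' + q * s') (r * p' + s * r') (r * q' + s * s')"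
  proof
    fix x :: real
    show "compose {0<..} f g x
      = lft (p * p' + q * r') (p * q' + q * s') (r * p' + s * r') (r * q' + s * s') x"
    proof (cases "x > 0")
      case True
      define n m where "n = p' * x + q'" and "m = r' * x + s'"
      have pos: "n > 0" "m > 0"
        using lft_rep_pos[OF g True] by (simp_all add: n_def m_def)
      have "compose {0<..} f g x = (p * (n / m) + q) / (r * (n / m) + s)"
        using True pos f g by (simp add: compose_eq lft_rep_apply n_def m_def)
      also have "\<dots> = (m * (p * (n / m) + q)) / (m * (r * (n / m) + s))"
        using pos by simp
      also have "\<dots> = (p * n + q * m) / (r * n + s * m)"
        using pos by (simp add: distrib_left mult.commute)
      also have "\<dots> = lft (p * p' + q * r') (p * q' + q * s') (r * p' + s * r') (r * q' + s * s') x"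
        using True by (simp add: lft_def n_def m_def algebra_simps)
      finally show ?thesis .
    qed (simp add: compose_def lft_def)
  qed
  with f g det show ?thesis
    by (simp add: lft_rep_def)
qed

text \<open>The free scalar \<open>c\<close> makes every positive scalar matrix represent the
  identity; this is what permits rescaling of matrices later.\<close>

lemma lft_rep_id: "c > 0 \<Longrightarrow> lft_rep (\<lambda>x\<in>{0<..}. x) c 0 0 c"
  by (auto simp: lft_rep_def lft_def)

lemma lft_rep_R_map: "a > 0 \<Longrightarrow> lft_rep (R_map a) 1 a 1 0"
  by (auto simp: lft_rep_def lft_def R_map_def field_simps intro!: restrict_ext)

lemma lft_rep_S_map: "b > 0 \<Longrightarrow> lft_rep (S_map b) 1 0 0 b"
  by (auto simp: lft_rep_def lft_def S_map_def)

text \<open>Division by \<open>\<delta>\<close> normalises the last coefficient to 1. Since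
  \<open>lft_rep\<close> excludes a vanishing determinant, \<open>lft_det f \<ge> 0\<close> becomes
  strict.\<close>

lemma LFT_plus_obtain_rep:
  assumes "f \<in> LFT_plus"
  obtains p q r where "lft_rep f p q r 1" "p \<ge> 0" "q \<ge> 0" "r \<ge> 0" "p - q * r > 0"
    "lft_det f = p - q * r" "lft_sigma f = p\<^sup>2"
proof -
  obtain \<alpha> \<beta> \<gamma> \<delta> where rep: "lft_rep f \<alpha> \<beta> \<gamma> \<delta>" "\<delta> \<noteq> 0" and "lft_det f \<ge> 0"
    using assms by (auto simp: LFT_plus_def)
  have nn: "\<alpha> \<ge> 0" "\<beta> \<ge> 0" "\<gamma> \<ge> 0" "\<delta> > 0" and det: "\<alpha> * \<delta> - \<beta> * \<gamma> \<noteq> 0"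
    and f: "f = lft \<alpha> \<beta> \<gamma> \<delta>"
    using rep by (auto simp: lft_rep_def)
  have eq: "\<alpha> / \<delta> - \<beta> / \<delta> * (\<gamma> / \<delta>) = (\<alpha> * \<delta> - \<beta> * \<gamma>) / \<delta>\<^sup>2"
    using nn by (simp add: field_simps power2_eq_square)
  have "lft \<alpha> \<beta> \<gamma> \<delta> = lft (\<alpha> / \<delta>) (\<beta> / \<delta>) (\<gamma> / \<delta>) 1"
  proof (unfold lft_def, intro restrict_ext)
    fix x :: real assume "x \<in> {0<..}"
    have "(\<alpha> / \<delta> * x + \<beta> / \<delta>) / (\<gamma> / \<delta> * x + 1)
      = ((\<alpha> * x + \<beta>) / \<delta>) / ((\<gamma> * x + \<delta>) / \<delta>)"
      using nn by (simp add: add_divide_distrib)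
    then show "(\<alpha> * x + \<beta>) / (\<gamma> * x + \<delta>) = (\<alpha> / \<delta> * x + \<beta> / \<delta>) / (\<gamma> / \<delta> * x + 1)"
      using nn by simp
  qed
  then have rep1: "lft_rep f (\<alpha> / \<delta>) (\<beta> / \<delta>) (\<gamma> / \<delta>) 1"
    using nn det eq f by (simp add: lft_rep_def)
  have "\<alpha> / \<delta> - \<beta> / \<delta> * (\<gamma> / \<delta>) > 0"
    using \<open>lft_det f \<ge> 0\<close> lft_det_eq[OF rep1] rep1 by (simp add: lft_rep_def less_le)
  then show thesis
    using that[OF rep1] nn lft_det_eq[OF rep1] lft_sigma_eq[OF rep1] by simp
qed

section \<open>The condition holds on the closure\<close>

lemma powi_bracket:
  fixes b u :: real
  assumes "b > 1" "u > 0"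
  obtains k :: int where "b powi k \<le> u" "u < b powi (k + 1)"
proof
  have eq: "b powi j = b powr real_of_int j" for j
    using assms by (simp add: powr_real_of_int')
  have u: "u = b powr log b u"
    using assms by simp
  show "b powi \<lfloor>log b u\<rfloor> \<le> u"
    unfolding eq by (subst u, rule powr_mono) (use assms in auto)
  show "u < b powi (\<lfloor>log b u\<rfloor> + 1)"
    unfolding eq by (subst u, rule powr_less_mono) (use assms in linarith)+
qed

lemma powi_less_iff:
  fixes b :: real
  assumes "b > 1"
  shows "b powi m < b powi n \<longleftrightarrow> m < n"
  using assms by (simp add: powr_real_of_int'[symmetric])

section \<open>An integer attached to each composition\<close>

text \<open>With \<open>J x = a / x\<close>, the second alternative for \<open>f\<close> is the
  first one for \<open>J\<close> after \<open>f\<close>, with the same \<open>k\<close>. Compared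
  with \<open>J\<close> after \<open>f\<close>, \<open>R\<close> after \<open>f\<close> adds the
  lower row to the upper one: the determinant stays, and only entries on the larger sides grow.
  Hence \<open>R\<close> swaps the alternatives and keeps \<open>k\<close>, while \<open>S\<close>
  keeps the alternative and shifts \<open>k\<close> by one.\<close>

lemma Lambda_rep:
  assumes a: "a > 0" and b: "b > 1" and f: "f \<in> Lambda a b"
  shows "\<exists>p q r s (k::int). lft_rep f p q r s \<and>
    (p * s - q * r > 0 \<and> p * s - q * r \<le> b powi k * s\<^sup>2 \<and> b powi k * (p * s - q * r) \<le> p\<^sup>2
   \<or> q * r - p * s > 0 \<and> a * (q * r - p * s) \<le> b powi k * q\<^sup>2
       \<and> b powi k * (q * r - p * s) \<le> a * r\<^sup>2)"
  using f
proof induction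
  case Lambda_id
  have "(1::real) * 1 - 0 * 0 > 0 \<and> (1::real) * 1 - 0 * 0 \<le> b powi 0 * 1\<^sup>2 \<and>
    b powi 0 * (1 * 1 - 0 * 0) \<le> 1\<^sup>2"
    by simp
  then show ?case
    using lft_rep_id[of 1, OF zero_less_one] by blast
next
  case (Lambda_R f)
  then obtain p q r s k where rep: "lft_rep f p q r s" and
    cases: "p * s - q * r > 0 \<and> p * s - q * r \<le> b powi k * s\<^sup>2 \<and> b powi k * (p * s - q * r) \<le> p\<^sup>2
   \<or> q * r - p * s > 0 \<and> a * (q * r - p * s) \<le> b powi k * q\<^sup>2
       \<and> b powi k * (q * r - p * s) \<le> a * r\<^sup>2"
    by blast
  have nn: "p \<ge> 0" "q \<ge> 0" "r \<ge> 0" "s \<ge> 0"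
    using rep by (auto simp: lft_rep_def)
  have bk: "b powi k > 0"
    using b by simp
  have rep': "lft_rep (compose {0<..} (R_map a) f) (p + a * r) (q + a * s) p q"
    using lft_rep_compose[OF lft_rep_R_map[OF a] rep] by simp
  have D: "(q + a * s) * p - (p + a * r) * q = a * (p * s - q * r)"
    by (simp add: algebra_simps)
  from cases show ?case
  proof
    assume h: "p * s - q * r > 0 \<and> p * s - q * r \<le> b powi k * s\<^sup>2 \<and> b powi k * (p * s - q * r) \<le> p\<^sup>2"
    have "a * (a * (p * s - q * r)) \<le> a * (a * (b powi k * s\<^sup>2))"
      using h a by (intro mult_left_mono) auto
    also have "\<dots> = b powi k * (a * s)\<^sup>2"
      by (simp add: power2_eq_square)
    also have "\<dots> \<le> b powi k * (q + a * s)\<^sup>2"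
      using nn a bk by (intro mult_left_mono power_mono) auto
    finally have 1: "a * (a * (p * s - q * r)) \<le> b powi k * (q + a * s)\<^sup>2" .
    have "a * (b powi k * (p * s - q * r)) \<le> a * p\<^sup>2"
      using h a by (intro mult_left_mono) auto
    then have 2: "b powi k * (a * (p * s - q * r)) \<le> a * p\<^sup>2"
      by (simp only: mult.left_commute)
    have 3: "a * (p * s - q * r) > 0"
      using h a by simp
    show ?thesis
      using rep' 1 2 3 unfolding D[symmetric] by blast
  next
    assume h: "q * r - p * s > 0 \<and> a * (q * r - p * s) \<le> b powi k * q\<^sup>2
       \<and> b powi k * (q * r - p * s) \<le> a * r\<^sup>2"
    have D': "(p + a * r) * q - (q + a * s) * p = a * (q * r - p * s)"
      by (simp add: algebra_simps)
    have "a * (b powi k * (q * r - p * s)) \<le> a * (a * r\<^sup>2)"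
      using h a by (intro mult_left_mono) auto
    also have "\<dots> = (a * r)\<^sup>2"
      by (simp add: power2_eq_square)
    also have "\<dots> \<le> (p + a * r)\<^sup>2"
      using nn a by (intro power_mono) auto
    finally have 1: "b powi k * (a * (q * r - p * s)) \<le> (p + a * r)\<^sup>2"
      by (simp only: mult.left_commute)
    have 2: "a * (q * r - p * s) > 0"
      using h a by simp
    show ?thesis
      using rep' 1 2 h unfolding D'[symmetric] by blast
  qed
next
  case (Lambda_S f)
  then obtain p q r s k where rep: "lft_rep f p q r s" and
    cases: "p * s - q * r > 0 \<and> p * s - q * r \<le> b powi k * s\<^sup>2 \<and> b powi k * (p * s - q * r) \<le> p\<^sup>2
   \<or> q * r - p * s > 0 \<and> a * (q * r - p * s) \<le> b powi k * q\<^sup>2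
       \<and> b powi k * (q * r - p * s) \<le> a * r\<^sup>2"
    by blast
  have b0: "b > 0" "b \<noteq> 0"
    using b by auto
  have rep': "lft_rep (compose {0<..} (S_map b) f) p q (b * r) (b * s)"
    using lft_rep_compose[OF lft_rep_S_map[OF b0(1)] rep] by simp
  have D: "p * (b * s) - q * (b * r) = b * (p * s - q * r)"
    "q * (b * r) - p * (b * s) = b * (q * r - p * s)"
    by (simp_all add: algebra_simps)
  from cases show ?case
  proof
    assume h: "p * s - q * r > 0 \<and> p * s - q * r \<le> b powi k * s\<^sup>2 \<and> b powi k * (p * s - q * r) \<le> p\<^sup>2"
    \<comment> \<open>Following \<open>f\<close> by division by \<open>b\<close> lowers the exponent
      by one.\<close>
    have k: "b powi k = b * b powi (k - 1)"
      using b0 by (simp add: power_int_diff)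
    have "b * (p * s - q * r) \<le> b * (b powi k * s\<^sup>2)"
      using h b0 by (intro mult_left_mono) auto
    also have "\<dots> = b powi (k - 1) * (b * s)\<^sup>2"
      unfolding k by (simp add: power2_eq_square)
    finally have 1: "b * (p * s - q * r) \<le> b powi (k - 1) * (b * s)\<^sup>2" .
    have 2: "b powi (k - 1) * (b * (p * s - q * r)) \<le> p\<^sup>2"
      using h unfolding k by (simp add: mult_ac)
    have 3: "b * (p * s - q * r) > 0"
      using h b0 by simp
    show ?thesis
      using rep' 1 2 3 unfolding D[symmetric] by blast
  next
    assume h: "q * r - p * s > 0 \<and> a * (q * r - p * s) \<le> b powi k * q\<^sup>2
       \<and> b powi k * (q * r - p * s) \<le> a * r\<^sup>2"
    \<comment> \<open>Here the exponent rises instead, because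
      \<open>J (x / b) = b * J x\<close>.\<close>
    have k: "b powi (k + 1) = b * b powi k"
      using b0 by (simp add: power_int_add)
    have "b * (a * (q * r - p * s)) \<le> b * (b powi k * q\<^sup>2)"
      using h b0 by (intro mult_left_mono) auto
    then have 1: "a * (b * (q * r - p * s)) \<le> b powi (k + 1) * q\<^sup>2"
      unfolding k by (simp add: mult_ac)
    have "b\<^sup>2 * (b powi k * (q * r - p * s)) \<le> b\<^sup>2 * (a * r\<^sup>2)"
      using h b0 by (intro mult_left_mono) auto
    then have 2: "b powi (k + 1) * (b * (q * r - p * s)) \<le> a * (b * r)\<^sup>2"
      unfolding k by (simp add: mult_ac power2_eq_square)
    have 3: "b * (q * r - p * s) > 0"
      using h b0 by simp
    show ?thesis
      using rep' 1 2 3 unfolding D(2)[symmetric] by blast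
  qed
qed

text \<open>The sign of the determinant decides whether the map increases, so comparing two values
  selects the first alternative of \<open>Lambda_rep\<close>. There
  \<open>p * s > q * r \<ge> 0\<close> forces \<open>s > 0\<close>, and both inequalities can be
  divided by the square of \<open>s\<close>.\<close>

lemma Lambda_increasing_rep:
  assumes a: "a > 0" and b: "b > 1" and f: "f \<in> Lambda a b" and less: "f 1 < f 2"
  shows "\<exists>p q r (k::int). lft_rep f p q r 1 \<and> p - q * r > 0 \<and>
    p - q * r \<le> b powi k \<and> b powi k * (p - q * r) \<le> p\<^sup>2"
proof -
  obtain p q r s k where rep: "lft_rep f p q r s" and
    cases: "p * s - q * r > 0 \<and> p * s - q * r \<le> b powi k * s\<^sup>2 \<and> b powi k * (p * s - q * r) \<le> p\<^sup>2
      \<or> q * r - p * s > 0"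
    using Lambda_rep[OF a b f] by blast
  have nn: "p \<ge> 0" "q \<ge> 0" "r \<ge> 0" "s \<ge> 0"
    using rep by (auto simp: lft_rep_def)
  have "(p * 1 + q) / (r * 1 + s) < (p * 2 + q) / (r * 2 + s)"
    using less rep by (simp add: lft_rep_apply del: mult_1_right)
  then have "(p + q) * (r * 2 + s) < (p * 2 + q) * (r + s)"
    using lft_rep_pos[OF rep, of 1] lft_rep_pos[OF rep, of 2] by (simp add: divide_simps)
  then have pos: "p * s - q * r > 0"
    by (simp add: algebra_simps)
  with cases have h: "p * s - q * r \<le> b powi k * s\<^sup>2" "b powi k * (p * s - q * r) \<le> p\<^sup>2"
    by auto
  have "p * s > 0"
    using pos mult_nonneg_nonneg[OF nn(2,3)] by linarith
  then have "s \<noteq> 0"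
    by auto
  with nn have s: "s > 0"
    by simp
  have D: "p / s - q / s * (r / s) = (p * s - q * r) / s\<^sup>2"
    using s by (simp add: field_simps power2_eq_square)
  have "f \<in> LFT_plus"
    using rep s pos by (auto simp: LFT_plus_def LFT_def lft_det_eq)
  then obtain p' q' r' where rep': "lft_rep f p' q' r' 1" "p' - q' * r' > 0"
    by (rule LFT_plus_obtain_rep)
  have eq: "p' = p / s" "q' = q / s" "r' = r / s"
    using lft_rep_unique[OF rep _ rep'(1)] s by auto
  have "(p * s - q * r) / s\<^sup>2 \<le> b powi k"
    using h(1) s by (simp add: divide_le_eq)
  moreover have "b powi k * ((p * s - q * r) / s\<^sup>2) \<le> (p / s)\<^sup>2"
    using h(2) s by (simp add: power_divide divide_le_cancel)
  ultimately show ?thesis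
    using rep' D unfolding eq by (metis (no_types))
qed

section \<open>Recovery of the coefficients from values\<close>

text \<open>Clearing denominators gives three equations linear in \<open>p\<close>,
  \<open>q\<close>, \<open>r\<close>; the second difference eliminates \<open>p\<close> and
  \<open>q\<close>. The remaining coefficient of \<open>r\<close>, multiplied by the three
  denominators, equals \<open>2 * (p - q * r)\<close>, hence is positive.\<close>

lemma lft_three_points:
  fixes p q r y1 y2 y3 :: real
  assumes "r \<ge> 0" "y1 = (p * 1 + q) / (r * 1 + 1)" "y2 = (p * 2 + q) / (r * 2 + 1)"
    "y3 = (p * 3 + q) / (r * 3 + 1)" "p - q * r > 0"
  shows "y1 - 4 * y2 + 3 * y3 > 0" "r = (2 * y2 - y1 - y3) / (y1 - 4 * y2 + 3 * y3)"
    "p = y2 * (2 * r + 1) - y1 * (r + 1)" "q = 2 * y1 * (r + 1) - y2 * (2 * r + 1)"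
proof -
  have e: "y1 * (r + 1) = p + q" "y2 * (2 * r + 1) = 2 * p + q" "y3 * (3 * r + 1) = 3 * p + q"
    using assms(1) by (simp_all add: assms(2-4) field_simps)
  then show "p = y2 * (2 * r + 1) - y1 * (r + 1)" "q = 2 * y1 * (r + 1) - y2 * (2 * r + 1)"
    by auto
  have "(y1 - 4 * y2 + 3 * y3) * ((r + 1) * (2 * r + 1) * (3 * r + 1)) =
      (p + q) * ((2 * r + 1) * (3 * r + 1)) - 4 * (2 * p + q) * ((r + 1) * (3 * r + 1))
       + 3 * (3 * p + q) * ((r + 1) * (2 * r + 1))"
    unfolding e[symmetric] by algebra
  also have "\<dots> = 2 * (p - q * r)"
    by algebra
  finally have "(y1 - 4 * y2 + 3 * y3) * ((r + 1) * (2 * r + 1) * (3 * r + 1)) > 0"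
    using assms(5) by simp
  then show pos: "y1 - 4 * y2 + 3 * y3 > 0"
    by (rule zero_less_mult_pos2) (use assms(1) in simp)
  have "r * (y1 - 4 * y2 + 3 * y3) = 2 * y2 - y1 - y3"
    using e by algebra
  then show "r = (2 * y2 - y1 - y3) / (y1 - 4 * y2 + 3 * y3)"
    using pos by (simp add: eq_divide_eq)
qed

text \<open>The formulas of \<open>lft_three_points\<close> are continuous at the values of the
  limit, since the denominator in the formula for \<open>r\<close> is nonzero there.\<close>

lemma lft_coeffs_tendsto:
  fixes P Q R :: "nat \<Rightarrow> real"
  assumes g: "\<forall>\<^sub>F n in sequentially. lft_rep (g n) (P n) (Q n) (R n) 1 \<and> P n - Q n * R n > 0"
    and h: "lft_rep h p q r 1" "p - q * r > 0"
    and lim: "\<And>x. x > 0 \<Longrightarrow> (\<lambda>n. g n x) \<longlonglongrightarrow> h x"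
  shows "P \<longlonglongrightarrow> p" "Q \<longlonglongrightarrow> q" "R \<longlonglongrightarrow> r"
proof -
  have pts: "r \<ge> 0" "f 1 = (p * 1 + q) / (r * 1 + 1)" "f 2 = (p * 2 + q) / (r * 2 + 1)"
    "f 3 = (p * 3 + q) / (r * 3 + 1)" if "lft_rep f p q r 1" for f p q r
    using that lft_rep_apply[OF that] by (auto simp: lft_rep_def)
  note H = lft_three_points[OF pts[OF h(1)] h(2)]
  have G: "R n = (2 * g n 2 - g n 1 - g n 3) / (g n 1 - 4 * g n 2 + 3 * g n 3)"
    "P n = g n 2 * (2 * R n + 1) - g n 1 * (R n + 1)"
    "Q n = 2 * g n 1 * (R n + 1) - g n 2 * (2 * R n + 1)"
    if "lft_rep (g n) (P n) (Q n) (R n) 1 \<and> P n - Q n * R n > 0" for n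
    using lft_three_points[OF pts[of "g n" "P n" "Q n" "R n"]] that by blast+
  have lims: "(\<lambda>n. g n 1) \<longlonglongrightarrow> h 1" "(\<lambda>n. g n 2) \<longlonglongrightarrow> h 2" "(\<lambda>n. g n 3) \<longlonglongrightarrow> h 3"
    by (simp_all add: lim)
  have "(\<lambda>n. (2 * g n 2 - g n 1 - g n 3) / (g n 1 - 4 * g n 2 + 3 * g n 3))
    \<longlonglongrightarrow> (2 * h 2 - h 1 - h 3) / (h 1 - 4 * h 2 + 3 * h 3)"
    using H(1) by (intro tendsto_intros lims) auto
  then show R: "R \<longlonglongrightarrow> r"
    unfolding H(2)[symmetric]
    by (rule Lim_transform_eventually) (use g in eventually_elim, metis G(1))
  have "(\<lambda>n. g n 2 * (2 * R n + 1) - g n 1 * (R n + 1)) \<longlonglongrightarrow> p"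
    by (subst H(3)) (intro tendsto_intros lims R)
  then show "P \<longlonglongrightarrow> p"
    by (rule Lim_transform_eventually) (use g in eventually_elim, metis G(2))
  have "(\<lambda>n. 2 * g n 1 * (R n + 1) - g n 2 * (2 * R n + 1)) \<longlonglongrightarrow> q"
    by (subst H(4)) (intro tendsto_intros lims R)
  then show "Q \<longlonglongrightarrow> q"
    by (rule Lim_transform_eventually) (use g in eventually_elim, metis G(3))
qed

text \<open>The exponents \<open>K n\<close> of the approximants need not converge. Instead
  \<open>k\<close> is read off the limit, as the largest exponent compatible with the second bound
  of \<open>U_set\<close>; discreteness of the exponents then yields the first bound.\<close>

lemma Lambda_bar_imp_U_set:
  assumes a: "a > 0" and b: "b > 1" and h: "h \<in> Lambda_bar a b" "h \<in> LFT_plus"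
  shows "\<exists>k. h \<in> U_set b k"
proof -
  obtain p q r where rep: "lft_rep h p q r 1" and nn: "p \<ge> 0" "q \<ge> 0" "r \<ge> 0"
    and pos: "p - q * r > 0" and det: "lft_det h = p - q * r" and sigma: "lft_sigma h = p\<^sup>2"
    using h(2) by (rule LFT_plus_obtain_rep)
  obtain g where g: "\<And>n. g n \<in> Lambda a b" and lim: "\<And>x. x > 0 \<Longrightarrow> (\<lambda>n. g n x) \<longlonglongrightarrow> h x"
    using h(1) by (auto simp: Lambda_bar_def)
  have "(p * 1 + q) * (r * 2 + 1) < (p * 2 + q) * (r * 1 + 1)"
    using pos by (simp add: algebra_simps)
  then have "h 1 < h 2"
    using lft_rep_pos[OF rep, of 1] lft_rep_pos[OF rep, of 2] rep
    by (simp add: lft_rep_apply divide_simps)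
  \<comment> \<open>A value strictly between separates the two limits, so late approximants are
    increasing from 1 to 2 and have positive determinant.\<close>
  then obtain c where c: "h 1 < c" "c < h 2"
    using dense by blast
  have "\<forall>\<^sub>F n in sequentially. g n 1 < c" "\<forall>\<^sub>F n in sequentially. c < g n 2"
    using c lim[of 1] lim[of 2] by (auto dest: order_tendstoD)
  then have incr: "\<forall>\<^sub>F n in sequentially. g n 1 < g n 2"
    by eventually_elim simp
  have "\<forall>n. \<exists>p q r k. g n 1 < g n 2 \<longrightarrow> lft_rep (g n) p q r 1 \<and> p - q * r > 0 \<and>
    p - q * r \<le> b powi k \<and> b powi k * (p - q * r) \<le> p\<^sup>2"
    using Lambda_increasing_rep[OF a b g] by blast
  then obtain P Q R K where PQRK: "\<And>n. g n 1 < g n 2 \<Longrightarrow>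
    lft_rep (g n) (P n) (Q n) (R n) 1 \<and> P n - Q n * R n > 0 \<and>
    P n - Q n * R n \<le> b powi K n \<and> b powi K n * (P n - Q n * R n) \<le> (P n)\<^sup>2"
    by metis
  have "\<forall>\<^sub>F n in sequentially. lft_rep (g n) (P n) (Q n) (R n) 1 \<and> P n - Q n * R n > 0"
    using incr by eventually_elim (use PQRK in blast)
  note lims = lft_coeffs_tendsto[OF this rep pos lim]
  have "p > 0"
    using pos nn mult_nonneg_nonneg[of q r] by linarith
  then have u: "p\<^sup>2 / (p - q * r) > 0"
    using pos by simp
  obtain k where k: "b powi k \<le> p\<^sup>2 / (p - q * r)" "p\<^sup>2 / (p - q * r) < b powi (k + 1)"
    using powi_bracket[OF b u] .
  have "p - q * r \<le> b powi k"
  proof (rule ccontr)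
    assume "\<not> p - q * r \<le> b powi k"
    moreover have "(\<lambda>n. P n - Q n * R n) \<longlonglongrightarrow> p - q * r"
      by (intro tendsto_intros lims)
    ultimately have "\<forall>\<^sub>F n in sequentially. b powi k < P n - Q n * R n"
      by (simp add: order_tendstoD)
    moreover have "(\<lambda>n. (P n)\<^sup>2 / (P n - Q n * R n)) \<longlonglongrightarrow> p\<^sup>2 / (p - q * r)"
      using pos by (intro tendsto_intros lims) auto
    then have "\<forall>\<^sub>F n in sequentially. (P n)\<^sup>2 / (P n - Q n * R n) < b powi (k + 1)"
      using k(2) by (rule order_tendstoD)
    ultimately have "\<forall>\<^sub>F n in sequentially. False"
      using incr
    proof eventually_elim
      \<comment> \<open>The bounds on \<open>K n\<close> would place it strictly between
        \<open>k\<close> and \<open>k + 1\<close>.\<close>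
      case (elim n)
      note n = PQRK[OF elim(3)]
      have "b powi K n \<le> (P n)\<^sup>2 / (P n - Q n * R n)"
        using n by (simp add: pos_le_divide_eq)
      then have "b powi K n < b powi (k + 1)" "b powi k < b powi K n"
        using elim n by auto
      then show False
        unfolding powi_less_iff[OF b] by simp
    qed
    then show False
      by simp
  qed
  moreover have "p - q * r \<le> b powi (- k) * p\<^sup>2"
    using k(1) pos b by (simp add: pos_le_divide_eq power_int_minus field_simps)
  ultimately show ?thesis
    using h(2) det sigma by (auto simp: U_set_def)
qed

section \<open>The closure of the matrix semigroup\<close>

text \<open>The quadruple \<open>(p, q, r, s)\<close> stands for the matrix with rows \<open>(p, q)\<close> and \<open>(r, s)\<close>.\<close>

type_synonym mat2 = "real \<times> real \<times> real \<times> real"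

fun mat2_mult :: "mat2 \<Rightarrow> mat2 \<Rightarrow> mat2" where
  "mat2_mult (p, q, r, s) (p', q', r', s')
    = (p * p' + q * r', p * q' + q * s', r * p' + s * r', r * q' + s * s')"

text \<open>All positive multiples of the matrix of a composition are included, so that the closure
  below is a closure up to scaling.\<close>

definition word_mats :: "real \<Rightarrow> real \<Rightarrow> mat2 set" where
  "word_mats a b = {(p, q, r, s). \<exists>f\<in>Lambda a b. lft_rep f p q r s}"

text \<open>The inductive definition attaches generators on the left only; associativity and
  induction on the left factor give closure under arbitrary composition.\<close>

lemma Lambda_compose:
  assumes b: "b > 0" and a: "a > 0" and f: "f \<in> Lambda a b" and g: "g \<in> Lambda a b"
  shows "compose {0<..} f g \<in> Lambda a b"
proof -
  have g_maps: "g \<in> {0<..} \<rightarrow> {0<..}" if "g \<in> Lambda a b" for g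
    using that by induction
      (use a b in \<open>auto simp: compose_def R_map_def S_map_def Pi_iff add_pos_pos\<close>)
  have ext: "g \<in> extensional {0<..}"
    using g by induction (auto simp: compose_def extensional_def)
  from f show ?thesis
  proof induction
    case Lambda_id
    have "compose {0<..} (\<lambda>x\<in>{0<..}. x) g = g"
      using g_maps[OF g] ext by (rule Id_compose)
    then have "compose {0<..} (\<lambda>x\<in>{0<..}. x) g \<in> Lambda a b"
      using g by (simp only:)
    then show ?case .
  next
    case (Lambda_R f)
    have "compose {0<..} (compose {0<..} (R_map a) f) g
      = compose {0<..} (R_map a) (compose {0<..} f g)"
      using g_maps[OF g] by (rule compose_assoc[symmetric])
    then show ?case
      using Lambda_R Lambda.Lambda_R by metis
  next
    case (Lambda_S f)
    have "compose {0<..} (compose {0<..} (S_map b) f) g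
      = compose {0<..} (S_map b) (compose {0<..} f g)"
      using g_maps[OF g] by (rule compose_assoc[symmetric])
    then show ?case
      using Lambda_S Lambda.Lambda_S by metis
  qed
qed

lemma continuous_mat2_mult:
  "continuous_on UNIV (\<lambda>(M, N). mat2_mult M N)"
proof -
  have "(\<lambda>(M, N). mat2_mult M N) = (\<lambda>z.
    (fst (fst z) * fst (snd z) + fst (snd (fst z)) * fst (snd (snd (snd z))),
     fst (fst z) * fst (snd (snd z)) + fst (snd (fst z)) * snd (snd (snd (snd z))),
     fst (snd (snd (fst z))) * fst (snd z) + snd (snd (snd (fst z))) * fst (snd (snd (snd z))),
     fst (snd (snd (fst z))) * fst (snd (snd z)) + snd (snd (snd (fst z))) * snd (snd (snd (snd z)))))"
    by (auto simp: fun_eq_iff)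
  then show ?thesis
    by (auto intro!: continuous_intros)
qed

context
  fixes a b :: real
  assumes a: "a > 0" and b: "b > 1"
begin

lemma word_mats_mult:
  assumes "M \<in> word_mats a b" "N \<in> word_mats a b"
  shows "mat2_mult M N \<in> word_mats a b"
proof -
  obtain p q r s f where M: "M = (p, q, r, s)" "f \<in> Lambda a b" "lft_rep f p q r s"
    using assms(1) by (auto simp: word_mats_def)
  obtain p' q' r' s' g where N: "N = (p', q', r', s')" "g \<in> Lambda a b" "lft_rep g p' q' r' s'"
    using assms(2) by (auto simp: word_mats_def)
  have "compose {0<..} f g \<in> Lambda a b"
    using a b M(2) N(2) by (intro Lambda_compose) auto
  with lft_rep_compose[OF M(3) N(3)] show ?thesis
    by (auto simp: word_mats_def M(1) N(1))
qed

lemma word_mats_scalar: "c > 0 \<Longrightarrow> (c, 0, 0, c) \<in> word_mats a b"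
  using lft_rep_id Lambda.Lambda_id by (auto simp: word_mats_def)

lemma word_mats_R: "(1, a, 1, 0) \<in> word_mats a b"
proof -
  have "lft_rep (compose {0<..} (R_map a) (\<lambda>x\<in>{0<..}. x)) 1 a 1 0"
    using lft_rep_compose[OF lft_rep_R_map[OF a] lft_rep_id[of 1]] by simp
  then show ?thesis
    using Lambda.Lambda_R[OF Lambda.Lambda_id] by (auto simp: word_mats_def)
qed

lemma word_mats_S: "(1, 0, 0, b) \<in> word_mats a b"
proof -
  have "lft_rep (compose {0<..} (S_map b) (\<lambda>x\<in>{0<..}. x)) 1 0 0 b"
    using lft_rep_compose[OF lft_rep_S_map[of b] lft_rep_id[of 1]] b by simp
  then show ?thesis
    using Lambda.Lambda_S[OF Lambda.Lambda_id] by (auto simp: word_mats_def)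
qed

text \<open>Multiplication is continuous, and the closure of a product set is the product of the
  closures.\<close>

lemma closure_mult:
  assumes M: "M \<in> closure (word_mats a b)" and N: "N \<in> closure (word_mats a b)"
  shows "mat2_mult M N \<in> closure (word_mats a b)"
proof -
  have "(\<lambda>(M, N). mat2_mult M N) ` closure (word_mats a b \<times> word_mats a b) \<subseteq> closure (word_mats a b)"
  proof (rule image_closure_subset)
    show "continuous_on (closure (word_mats a b \<times> word_mats a b)) (\<lambda>(M, N). mat2_mult M N)"
      using continuous_mat2_mult by (rule continuous_on_subset) simp
    show "(\<lambda>(M, N). mat2_mult M N) ` (word_mats a b \<times> word_mats a b) \<subseteq> closure (word_mats a b)"
      using word_mats_mult closure_subset by fastforce
  qed simp
  then show ?thesis
    using M N by (auto simp: closure_Times)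
qed

lemma closure_scale:
  assumes "c > 0" "(p, q, r, s) \<in> closure (word_mats a b)"
  shows "(c * p, c * q, c * r, c * s) \<in> closure (word_mats a b)"
  using closure_mult[OF subsetD[OF closure_subset word_mats_scalar[OF assms(1)]] assms(2)] by simp

section \<open>Elementary matrices in the closure\<close>

lemma closure_inversion: "(0, a, 1, 0) \<in> closure (word_mats a b)"
proof -
  have "((1 / b) ^ m, a, 1, 0) \<in> word_mats a b" for m
  proof (induction m)
    case 0
    show ?case using word_mats_R by simp
  next
    case (Suc m)
    \<comment> \<open>Putting \<open>S\<close> on both sides multiplies the two off-diagonal entries
      by \<open>b\<close>; the scalar matrix undoes this and shrinks the corner entry
      instead.\<close>
    have "mat2_mult (1 / b, 0, 0, 1 / b)
      (mat2_mult (1, 0, 0, b) (mat2_mult ((1 / b) ^ m, a, 1, 0) (1, 0, 0, b))) \<in> word_mats a b"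
      using Suc b by (intro word_mats_mult word_mats_S word_mats_scalar) auto
    then show ?case
      using b by simp
  qed
  moreover have "(\<lambda>m. ((1 / b) ^ m, a, 1, 0)) \<longlonglongrightarrow> (0, a, 1, 0)"
    using b by (intro tendsto_intros LIMSEQ_realpow_zero) auto
  ultimately show ?thesis
    unfolding closure_sequential by (intro exI[of _ "\<lambda>m. ((1 / b) ^ m, a, 1, 0)"]) simp
qed

lemma closure_dilation: "(b powi k, 0, 0, 1) \<in> closure (word_mats a b)"
proof -
  have S: "(1, 0, 0, b) \<in> closure (word_mats a b)"
    using word_mats_S closure_subset by blast
  have "mat2_mult (0, a, 1, 0) (mat2_mult (1, 0, 0, b) (0, a, 1, 0)) \<in> closure (word_mats a b)"
    by (intro closure_mult S closure_inversion)
  then have "(a * b, 0, 0, a) \<in> closure (word_mats a b)"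
    by simp
  from closure_scale[OF _ this, of "1 / a"] have up: "(b, 0, 0, 1) \<in> closure (word_mats a b)"
    using a by simp
  have down: "(1 / b, 0, 0, 1) \<in> closure (word_mats a b)"
    using closure_scale[OF _ S, of "1 / b"] b by simp
  have one: "(1, 0, 0, 1) \<in> closure (word_mats a b)"
    using word_mats_scalar[of 1] closure_subset by auto
  have pow: "(c ^ n, 0, 0, 1) \<in> closure (word_mats a b)"
    if "(c, 0, 0, 1) \<in> closure (word_mats a b)" for c n
  proof (induction n)
    case (Suc n)
    show ?case using closure_mult[OF that Suc] by simp
  qed (use one in simp)
  show ?thesis
    using pow[OF up, of "nat k"] pow[OF down, of "nat (- k)"]
    by (auto simp: power_int_def inverse_eq_divide)
qed

lemma closure_translation:
  assumes "t \<ge> 0"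
  shows "(1, t, 0, 1) \<in> closure (word_mats a b)"
proof -
  have R: "(1, a, 1, 0) \<in> closure (word_mats a b)"
    using word_mats_R closure_subset by blast
  have "(a, a, 0, a) \<in> closure (word_mats a b)"
    using closure_mult[OF R closure_inversion] by simp
  from closure_scale[OF _ this, of "1 / a"] have T: "(1, 1, 0, 1) \<in> closure (word_mats a b)"
    using a by simp
  \<comment> \<open>Conjugating the unit translation by a dilation rescales its step; multiples of
    these steps are dense in the nonnegative reals.\<close>
  have Tk: "(1, (1 / b) ^ m, 0, 1) \<in> closure (word_mats a b)" for m
    using closure_mult[OF closure_mult[OF closure_dilation[of "- int m"] T] closure_dilation[of "int m"]] b
    by (simp add: power_int_minus power_one_over inverse_eq_divide)
  have Tn: "(1, real n * (1 / b) ^ m, 0, 1) \<in> closure (word_mats a b)" for n m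
  proof (induction n)
    case 0
    show ?case using word_mats_scalar[of 1] closure_subset by auto
  next
    case (Suc n)
    show ?case using closure_mult[OF Suc Tk[of m]] by (simp add: distrib_right add.commute)
  qed
  \<comment> \<open>Rounding \<open>t\<close> down to a multiple of the step costs at most one
    step.\<close>
  have "(\<lambda>m. real (nat \<lfloor>t * b ^ m\<rfloor>) * (1 / b) ^ m) \<longlonglongrightarrow> t"
  proof (rule tendsto_sandwich)
    have z: "(\<lambda>m. (1 / b) ^ m) \<longlonglongrightarrow> 0"
      using b by (intro LIMSEQ_realpow_zero) auto
    show "(\<lambda>m. t - (1 / b) ^ m) \<longlonglongrightarrow> t"
      using tendsto_diff[OF tendsto_const z] by simp
    have bounds: "t - (1 / b) ^ m \<le> real (nat \<lfloor>t * b ^ m\<rfloor>) * (1 / b) ^ m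
      \<and> real (nat \<lfloor>t * b ^ m\<rfloor>) * (1 / b) ^ m \<le> t" for m
    proof -
      define c where "c = b ^ m"
      have c: "c > 0" "(1 / b) ^ m = 1 / c"
        using b by (auto simp: c_def power_one_over)
      have "real (nat \<lfloor>t * c\<rfloor>) \<le> t * c" "t * c - 1 \<le> real (nat \<lfloor>t * c\<rfloor>)"
        using assms c by auto
      then have "real (nat \<lfloor>t * c\<rfloor>) / c \<le> t * c / c" "(t * c - 1) / c \<le> real (nat \<lfloor>t * c\<rfloor>) / c"
        using c(1) by (simp_all only: divide_right_mono less_imp_le)
      then show ?thesis
        unfolding c(2) c_def[symmetric] using c(1) by (simp add: diff_divide_distrib)
    qed
    then show "\<forall>\<^sub>F m in sequentially. t - (1 / b) ^ m \<le> real (nat \<lfloor>t * b ^ m\<rfloor>) * (1 / b) ^ m"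
      "\<forall>\<^sub>F m in sequentially. real (nat \<lfloor>t * b ^ m\<rfloor>) * (1 / b) ^ m \<le> t"
      by auto
  qed simp
  then have "(\<lambda>m. (1, real (nat \<lfloor>t * b ^ m\<rfloor>) * (1 / b) ^ m, 0, 1)) \<longlonglongrightarrow> (1, t, 0::real, 1::real)"
    by (intro tendsto_intros)
  with Tn have "(1, t, 0, 1) \<in> closure (closure (word_mats a b))"
    unfolding closure_sequential[of _ "closure (word_mats a b)"]
    by (intro exI[of _ "\<lambda>m. (1, real (nat \<lfloor>t * b ^ m\<rfloor>) * (1 / b) ^ m, 0, 1)"]) simp
  then show ?thesis
    by simp
qed

lemma closure_lower_unipotent:
  assumes "t \<ge> 0"
  shows "(1, 0, t, 1) \<in> closure (word_mats a b)"
proof -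
  have "mat2_mult (0, a, 1, 0) (mat2_mult (1, a * t, 0, 1) (0, a, 1, 0)) \<in> closure (word_mats a b)"
    using a assms by (intro closure_mult closure_inversion closure_translation) auto
  then have "(a, 0, a * t, a) \<in> closure (word_mats a b)"
    by simp
  from closure_scale[OF _ this, of "1 / a"] show ?thesis
    using a by simp
qed

text \<open>For \<open>q > 0\<close> the matrix factors as lower, upper, lower unipotent. The middle
  parameter is \<open>q\<close>, the diagonal entries fix the outer ones, and the determinant fixes
  \<open>r\<close>. Diagonal entries at least 1 make the outer parameters nonnegative.\<close>

lemma closure_det_one:
  assumes "p \<ge> 1" "s \<ge> 1" "q \<ge> 0" "r \<ge> 0" and det: "p * s - q * r = 1"
  shows "(p, q, r, s) \<in> closure (word_mats a b)"
proof (cases "q = 0")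
  case True
  have "p \<le> p * s" "s \<le> p * s" "p * s = 1"
    using assms(1,2) det True mult_left_mono[of 1 s p] mult_right_mono[of 1 p s] by simp_all
  then have "p = 1" "s = 1"
    using assms(1,2) by linarith+
  then show ?thesis
    using True assms closure_lower_unipotent by simp
next
  case False
  then have q: "q > 0"
    using assms by simp
  have "mat2_mult (1, 0, (s - 1) / q, 1) (mat2_mult (1, q, 0, 1) (1, 0, (p - 1) / q, 1))
    \<in> closure (word_mats a b)"
    using q assms by (intro closure_mult closure_translation closure_lower_unipotent) auto
  moreover have "(s - 1) / q * p + (p - 1) / q = r"
    using q det by (simp add: field_simps)
  ultimately show ?thesis
    using q by simp
qed

section \<open>Return from matrices to functions\<close>

text \<open>Entrywise convergence gives pointwise convergence of the quotients, because the limiting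
  denominator is positive on the half-line.\<close>

lemma closure_imp_Lambda_bar:
  assumes M: "(p, q, r, s) \<in> closure (word_mats a b)" and f: "lft_rep f p q r s"
  shows "f \<in> Lambda_bar a b"
proof -
  obtain Z where Z: "\<And>n. Z n \<in> word_mats a b" "Z \<longlonglongrightarrow> (p, q, r, s)"
    using M by (auto simp: closure_sequential)
  define P Q R S where "P = (\<lambda>n. fst (Z n))" and "Q = (\<lambda>n. fst (snd (Z n)))"
    and "R = (\<lambda>n. fst (snd (snd (Z n))))" and "S = (\<lambda>n. snd (snd (snd (Z n))))"
  have lims: "P \<longlonglongrightarrow> p" "Q \<longlonglongrightarrow> q" "R \<longlonglongrightarrow> r" "S \<longlonglongrightarrow> s"
    using tendsto_fst[OF Z(2)] tendsto_fst[OF tendsto_snd[OF Z(2)]]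
      tendsto_fst[OF tendsto_snd[OF tendsto_snd[OF Z(2)]]]
      tendsto_snd[OF tendsto_snd[OF tendsto_snd[OF Z(2)]]]
    by (simp_all add: P_def Q_def R_def S_def)
  have "\<forall>n. \<exists>g\<in>Lambda a b. lft_rep g (P n) (Q n) (R n) (S n)"
    using Z(1) by (fastforce simp: word_mats_def P_def Q_def R_def S_def split: prod.splits)
  then obtain g where g: "\<And>n. g n \<in> Lambda a b" "\<And>n. lft_rep (g n) (P n) (Q n) (R n) (S n)"
    by metis
  have "(\<lambda>n. g n x) \<longlonglongrightarrow> f x" if "x > 0" for x
  proof -
    have "(\<lambda>n. (P n * x + Q n) / (R n * x + S n)) \<longlonglongrightarrow> (p * x + q) / (r * x + s)"
      using lft_rep_pos[OF f that] by (intro tendsto_intros lims) auto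
    then show ?thesis
      using lft_rep_apply[OF g(2) that] lft_rep_apply[OF f that] by simp
  qed
  moreover have "f \<in> {0<..} \<rightarrow>\<^sub>E {0..}"
    using f by (auto simp: lft_rep_def lft_def)
  ultimately show ?thesis
    using g(1) by (auto simp: Lambda_bar_def)
qed

lemma U_set_imp_Lambda_bar:
  assumes "f \<in> U_set b k"
  shows "f \<in> Lambda_bar a b"
proof -
  have f: "f \<in> LFT_plus" and le: "lft_det f \<le> b powi k" "lft_det f \<le> b powi (- k) * lft_sigma f"
    using assms by (auto simp: U_set_def)
  obtain p q r where rep: "lft_rep f p q r 1" and nn: "p \<ge> 0" "q \<ge> 0" "r \<ge> 0"
    and pos: "p - q * r > 0" and det: "lft_det f = p - q * r" and sigma: "lft_sigma f = p\<^sup>2"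
    using f by (rule LFT_plus_obtain_rep)
  \<comment> \<open>Precomposing \<open>f\<close> with division by \<open>c\<close> gives
    determinant \<open>e\<^sup>2\<close>, so dividing the matrix by \<open>e\<close> makes it 1. The
    two bounds defining \<open>U_set\<close> say exactly that the resulting diagonal entries
    \<open>1 / e\<close> and \<open>p / c / e\<close> are at least 1.\<close>
  define c e where "c = b powi k" and "e = sqrt ((p - q * r) / c)"
  have c: "c > 0"
    using b by (simp add: c_def)
  have e: "e > 0" "e\<^sup>2 = (p - q * r) / c"
    using c pos by (auto simp: e_def)
  have "e\<^sup>2 \<le> 1"
    using le(1) c det by (simp add: e(2) c_def[symmetric])
  then have "e \<le> 1"
    by (intro power2_le_imp_le[of e 1]) simp_all
  have "e\<^sup>2 \<le> (p / c)\<^sup>2"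
    using divide_right_mono[OF le(2), of c] c
    unfolding det sigma e(2) power_int_minus c_def[symmetric]
    by (simp add: field_simps power2_eq_square)
  then have "e \<le> p / c"
    by (rule power2_le_imp_le) (use c nn in simp)
  have "(p / c / e, q / e, r / c / e, 1 / e) \<in> closure (word_mats a b)"
  proof (rule closure_det_one)
    have "p / c / e * (1 / e) - q / e * (r / c / e) = (p - q * r) / c / e\<^sup>2"
      by (simp add: power2_eq_square diff_divide_distrib mult_ac)
    then show "p / c / e * (1 / e) - q / e * (r / c / e) = 1"
      using e pos c by simp
  qed (use \<open>e \<le> 1\<close> \<open>e \<le> p / c\<close> e(1) c nn in \<open>auto simp: le_divide_eq mult.commute\<close>)
  \<comment> \<open>The dilation by \<open>c\<close> on the right cancels the division by
    \<open>c\<close>; scaling by \<open>e\<close> then restores the original coefficients.\<close>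
  from closure_mult[OF this closure_dilation[of k]]
  have "(p / e, q / e, r / e, 1 / e) \<in> closure (word_mats a b)"
    using c by (simp add: c_def[symmetric])
  from closure_scale[OF e(1) this] have "(p, q, r, 1) \<in> closure (word_mats a b)"
    using e(1) by simp
  then show ?thesis
    using rep by (rule closure_imp_Lambda_bar)
qed

end

theorem theorem2p3:
  fixes a b :: real
  assumes "a > 0" and "b > 1"
  shows "Lambda_bar a b \<inter> LFT_plus = (\<Union>k::int. U_set b k)"
proof
  show "Lambda_bar a b \<inter> LFT_plus \<subseteq> (\<Union>k::int. U_set b k)"
    using Lambda_bar_imp_U_set[OF assms] by blast
  show "(\<Union>k::int. U_set b k) \<subseteq> Lambda_bar a b \<inter> LFT_plus"
    using U_set_imp_Lambda_bar[OF assms] by (auto simp: U_set_def)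
qed

end
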